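(* For any primitive set $A\subset\mathbb{Z}_{>1}$ and any prime $p>2$, we have $f(A_p)\le f(p)=\frac{1}{p\log p}$, where $A_p=\{n\in A: \text{the least prime factor of } n \text{ is } p\}$.
   Context: A set $A\subset\mathbb{Z}_{>1}$ is primitive if no member of $A$ divides another member of $A$. For $A\subset\mathbb{Z}_{>1}$, $f(A)=\sum_{a\in A}\frac{1}{a\log a}$, and $f(p)=f(\{p\})$. *)

theory Defs
  imports "HOL-Analysis.Analysis" "HOL-Computational_Algebra.Primes"
begin

definition primitive :: "nat set \<Rightarrow> bool" where
  "primitive A \<longleftrightarrow> A \<subseteq> {2..} \<and> (\<forall>a\<in>A. \<forall>b\<in>A. a dvd b \<longrightarrow> a = b)"

definition fterm :: "nat \<Rightarrow> real" where
  "fterm a = 1 / (real a * ln (real a))"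

definition f :: "nat set \<Rightarrow> real" where
  "f A = (\<Sum>\<^sub>\<infinity>a\<in>A. fterm a)"

definition least_prime_factor :: "nat \<Rightarrow> nat" where
  "least_prime_factor n = Min (prime_factors n)"

definition Ap :: "nat set \<Rightarrow> nat \<Rightarrow> nat set" where
  "Ap A p = {n \<in> A. least_prime_factor n = p}"

end

theory Submission
  imports Defs "HOL-Number_Theory.Prime_Powers"
begin

text \<open>
  Write the elements of \<open>A\<^sub>p\<close> as \<open>p k\<close>, where no prime below \<open>p\<close> divides \<open>k\<close>, and give \<open>p k\<close> the mass
  \<open>w k = 1 / (p k ln (p k))\<close>. Let \<open>\<Lambda>\<close> be the von Mangoldt function and let mass at \<open>k\<close> move down to
  \<open>k / q\<close> with probability \<open>\<Lambda> q / ln k\<close>; by \<open>\<Sum>\<^bsub>q dvd k\<^esub> \<Lambda> q = ln k\<close> all of it ends up at \<open>1\<close>. Since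
  \<open>A\<close> is primitive, no path meets \<open>A\<close> twice, so the total mass is at most \<open>w 1 = f p\<close> once one
  knows that the full system of masses \<open>w\<close> sends at most \<open>w k\<close> into \<open>k\<close>, that is,
  \<open>\<Sum>\<^sub>q \<Lambda> q / (q ln (p k q) ln (k q)) \<le> 1 / ln (p k)\<close>, where \<open>q\<close> runs over the powers of primes \<open>\<ge> p\<close>.
  By partial summation this follows from the Mertens-type bound
  \<open>\<Sum>\<^bsub>q \<le> m\<^esub> \<Lambda> q / q \<le> ln m - ln p / 2\<close> over the same \<open>q\<close>, for \<open>m \<ge> p\<close>. For \<open>p \<ge> 17\<close> it comes from
  upper and lower Mertens estimates with explicit constants; the primes below 17 are reduced to
  \<open>p = 3\<close>, where the powers of 2 are removed from the full sum if \<open>m \<ge> 32\<close>, and smaller \<open>m\<close> are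
  computed.
\<close>

section \<open>Chebyshev and Mertens bounds\<close>

text \<open>Legendre's formula: from \<open>n\<close> to \<open>Suc n\<close> the quotient
  \<open>n div d\<close> grows, by 1, only for d dividing \<open>Suc n\<close>, and the \<Lambda>
  values of these d add up to \<open>ln (Suc n)\<close>.\<close>

lemma ln_fact_eq_sum_mangoldt:
  "ln (fact n :: real) = (\<Sum>d=1..n. mangoldt d * real (n div d))"
proof (induction n)
  case 0
  show ?case by simp
next
  case (Suc n)
  have "(\<Sum>d=1..Suc n. mangoldt d * real (Suc n div d)) =
        (\<Sum>d=1..Suc n. mangoldt d * real (n div d) + (if d dvd Suc n then mangoldt d else 0))"
    by (intro sum.cong refl) (auto simp: div_Suc algebra_simps mod_eq_0_iff_dvd)
  also have "\<dots> = ln (fact n) + (\<Sum>d=1..Suc n. if d dvd Suc n then mangoldt d else 0)"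
    by (simp add: sum.distrib Suc.IH)
  also have "(\<Sum>d=1..Suc n. if d dvd Suc n then mangoldt d else 0) =
      (\<Sum>d | d dvd Suc n. mangoldt d :: real)"
  proof -
    have "{d. d dvd Suc n} = {d \<in> {1..Suc n}. d dvd Suc n}"
      by (auto simp: Suc_le_eq intro: dvd_pos_nat dvd_imp_le)
    then show ?thesis
      by (simp only: sum.inter_filter finite_atLeastAtMost)
  qed
  also have "\<dots> = ln (real (Suc n))"
    by (subst mangoldt_sum) auto
  also have "ln (fact n) + ln (real (Suc n)) = ln (fact (Suc n))"
    by (simp add: ln_mult del: of_nat_Suc)
  finally show ?case ..
qed

lemma ln_Suc_minus_ln_le:
  assumes "n > 0"
  shows "real n * (ln (real (Suc n)) - ln (real n)) \<le> 1"
proof -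
  have "ln (real (Suc n) / real n) \<le> real (Suc n) / real n - 1"
    using assms by (intro ln_le_minus_one) auto
  also have "\<dots> = 1 / real n"
    using assms by (simp add: field_simps)
  finally show ?thesis
    using assms by (simp add: ln_div field_simps)
qed

lemma ln_Suc_minus_ln_ge:
  assumes "n > 0"
  shows "real (Suc n) * (ln (real (Suc n)) - ln (real n)) \<ge> 1"
proof -
  have "ln (real n / real (Suc n)) \<le> real n / real (Suc n) - 1"
    using assms by (intro ln_le_minus_one) auto
  also have "\<dots> = - 1 / real (Suc n)"
    by (simp add: field_simps)
  finally show ?thesis
    using assms by (simp add: ln_div field_simps)
qed

lemma ln_fact_le: "n > 0 \<Longrightarrow> ln (fact n :: real) \<le> real n * ln (real n) - real n + ln (real n) + 1"
proof (induction n rule: nat_induct_non_zero)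
  case (Suc n)
  have "ln (fact (Suc n) :: real) = ln (real (Suc n)) + ln (fact n)"
    by (simp add: ln_mult del: of_nat_Suc)
  then show ?case
    using Suc.IH ln_Suc_minus_ln_ge[OF Suc.hyps] by (simp add: algebra_simps)
qed simp

lemma ln_fact_ge: "n > 0 \<Longrightarrow> ln (fact n :: real) \<ge> real n * ln (real n) - real n"
proof (induction n rule: nat_induct_non_zero)
  case (Suc n)
  have "ln (fact (Suc n) :: real) = ln (real (Suc n)) + ln (fact n)"
    by (simp add: ln_mult del: of_nat_Suc)
  then show ?case
    using Suc.IH ln_Suc_minus_ln_le[OF Suc.hyps] by (simp add: algebra_simps)
qed simp

text \<open>Chebyshev's argument: in the logarithm of the binomial, \<Lambda> d has coefficient
  \<open>(a + b) div d - a div d - b div d\<close>. It is never negative, and at least 1 for b < d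
  \<le> a + b, where a \<le> b makes the last two quotients 0.\<close>

lemma sum_mangoldt_le_add_ln_binomial:
  assumes "a \<le> b"
  shows "(\<Sum>d=1..a + b. mangoldt d :: real) \<le> (\<Sum>d=1..b. mangoldt d) + ln (real ((a + b) choose a))"
proof -
  have ext: "ln (fact k :: real) = (\<Sum>d=1..a + b. mangoldt d * real (k div d))" if "k \<le> a + b" for k
    unfolding ln_fact_eq_sum_mangoldt using that by (intro sum.mono_neutral_left) auto
  have "real ((a + b) choose a) = fact (a + b) / (fact a * fact b)"
    by (simp add: binomial_fact)
  then have "ln (real ((a + b) choose a)) = ln (fact (a + b)) - ln (fact a) - ln (fact b)"
    by (simp add: ln_div ln_mult)
  also have "\<dots> = (\<Sum>d=1..a + b. mangoldt d * (real ((a + b) div d) - real (a div d) - real (b div d)))"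
    by (simp add: ext sum_subtractf right_diff_distrib)
  also have "\<dots> \<ge> (\<Sum>d=1..a + b. if d \<in> {b<..a + b} then mangoldt d else 0)"
  proof (intro sum_mono)
    fix d assume d: "d \<in> {1..a + b}"
    have "(if d \<in> {b<..a + b} then 1 else 0) + a div d + b div d \<le> (a + b) div d"
    proof (cases "d \<in> {b<..a + b}")
      case True
      then have "1 \<le> (a + b) div d"
        using d by (simp add: Suc_le_eq div_greater_zero_iff)
      with True assms show ?thesis by simp
    next
      case False
      have "a div d + b div d \<le> (a + b) div d"
        by (subst div_add1_eq) simp
      with False show ?thesis by auto
    qed
    then have "(if d \<in> {b<..a + b} then 1 else 0 :: real) \<le> real ((a + b) div d) - real (a div d) - real (b div d)"
      by (auto split: if_splits)
    from mult_left_mono[OF this mangoldt_nonneg[of d]]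
    show "(if d \<in> {b<..a + b} then mangoldt d else 0)
        \<le> mangoldt d * (real ((a + b) div d) - real (a div d) - real (b div d))"
      by (auto split: if_splits)
  qed
  finally have "(\<Sum>d\<in>{b<..a + b}. mangoldt d :: real) \<le> ln (real ((a + b) choose a))"
    by (subst (asm) sum.inter_restrict[symmetric]) (auto simp: Int_absorb1 subset_iff)
  moreover have "(\<Sum>d=1..a + b. mangoldt d :: real) = (\<Sum>d=1..b. mangoldt d) + (\<Sum>d\<in>{b<..a + b}. mangoldt d)"
    by (subst sum.union_disjoint[symmetric]) (auto intro!: sum.cong)
  ultimately show ?thesis by linarith
qed

lemma binomial_odd_middle_le: "(m + Suc m) choose m \<le> 4 ^ m"
proof -
  have "(m + Suc m) choose (Suc m) = (m + Suc m) choose m"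
    by (subst binomial_symmetric) auto
  then have "2 * ((m + Suc m) choose m) = (\<Sum>k\<in>{m, Suc m}. (m + Suc m) choose k)"
    by simp
  also have "\<dots> \<le> (\<Sum>k\<le>m + Suc m. (m + Suc m) choose k)"
    by (intro sum_mono2) auto
  also have "\<dots> = 2 ^ (m + Suc m)"
    by (rule choose_row_sum)
  also have "\<dots> = 2 * 4 ^ m"
    by (simp add: power_mult power_add power_mult_distrib[symmetric])
  finally show ?thesis by simp
qed

lemma ln_le_of_le_4_power: "0 < k \<Longrightarrow> k \<le> 4 ^ m \<Longrightarrow> ln (real k) \<le> real m * ln 4"
  using ln_mono[of "real k" "real (4 ^ m)"]
  by (metis ln_realpow of_nat_0_less_iff of_nat_mono of_nat_numeral of_nat_power zero_less_numeral zero_less_power)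

text \<open>Strong induction on halves: \<open>m + m\<close> and \<open>m + Suc m\<close> reduce to
  their larger half, and the binomial costs at most \<open>m * ln 4\<close>, exactly what the linear
  bound allows.\<close>

theorem sum_mangoldt_le: "(\<Sum>d=1..n. mangoldt d :: real) \<le> real n * ln 4"
proof (induction n rule: less_induct)
  case (less n)
  have "n \<le> 1 \<or> (\<exists>m\<ge>1. n = m + m) \<or> (\<exists>m\<ge>1. n = m + Suc m)"
    by presburger
  then consider "n \<le> 1" | m where "n = m + m" "m \<ge> 1" | m where "n = m + Suc m" "m \<ge> 1"
    by blast
  then show ?case
  proof cases
    case 1
    then have "n = 0 \<or> n = 1" by auto
    then show ?thesis by auto
  next
    case 2
    have "(m + m) choose m \<le> 2 ^ (m + m)" by (rule binomial_le_pow2)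
    also have "\<dots> = (4::nat) ^ m" by (simp add: power_add power_mult_distrib[symmetric])
    finally have "ln (real ((m + m) choose m)) \<le> real m * ln 4"
      by (intro ln_le_of_le_4_power) auto
    then show ?thesis
      using sum_mangoldt_le_add_ln_binomial[of m m] less.IH[of m] 2 by (simp add: algebra_simps)
  next
    case 3
    have "ln (real ((m + Suc m) choose m)) \<le> real m * ln 4"
      by (intro ln_le_of_le_4_power binomial_odd_middle_le) (simp add: zero_less_binomial_iff del: add_Suc_right)
    then show ?thesis
      using sum_mangoldt_le_add_ln_binomial[of m "Suc m"] less.IH[of "Suc m"] 3
      by (simp add: algebra_simps del: sum.cl_ivl_Suc)
  qed
qed

text \<open>
  The fractional part of \<open>u = n / d\<close> is at most \<open>min 1 (u - 1)\<close>, and this is bounded by counting the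
  points \<open>1 + j / K\<close> that do not exceed \<open>u\<close>.
\<close>
lemma frac_div_le_count:
  fixes n d K :: nat
  assumes "0 < d" "d \<le> n" "0 < K"
  shows "real n / real d - real (n div d) \<le>
    (\<Sum>j<K. if d \<le> n * K div (K + j) then 1 / real K else 0)"
proof -
  \<comment> \<open>Writing u = n / d, the point 1 + j / K is at most u iff j \<le> y. The ceiling
    makes \<open>m / K\<close> large enough, while every j < m still satisfies j \<le> y.\<close>
  define y where "y = real K * (real n / real d - 1)"
  define m where "m = min K (nat \<lceil>y\<rceil>)"
  have "real n / real d - real (n div d) \<le> min 1 (real n / real d - 1)"
  proof -
    have "n div d \<ge> 1"
      using assms by (simp add: Suc_le_eq div_greater_zero_iff)
    moreover have "real n / real d < real (n div d) + 1"
      using floor_divide_of_nat_eq[of n d, where ?'a = real] by linarith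
    ultimately show ?thesis by linarith
  qed
  also have "\<dots> = min (real K) y / real K"
    using assms by (simp add: y_def min_def field_simps)
  also have "\<dots> \<le> real m / real K"
    by (intro divide_right_mono) (simp_all add: m_def min_def, linarith)
  also have "\<dots> = (\<Sum>j<m. 1 / real K)"
    by simp
  also have "\<dots> \<le> (\<Sum>j<K. if d \<le> n * K div (K + j) then 1 / real K else 0)"
  proof -
    have "d \<le> n * K div (K + j)" if "j < m" for j
    proof -
      have "real j \<le> y" using that unfolding m_def by linarith
      then have "real (d * (K + j)) \<le> real (n * K)"
        using assms by (simp add: y_def field_simps)
      then have "d * (K + j) \<le> n * K" by linarith
      then show ?thesis
        using assms by (simp add: less_eq_div_iff_mult_less_eq)
    qed
    then have "(\<Sum>j<m. 1 / real K) = (\<Sum>j<m. if d \<le> n * K div (K + j) then 1 / real K else 0)"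
      by (intro sum.cong) auto
    also have "\<dots> \<le> (\<Sum>j<K. if d \<le> n * K div (K + j) then 1 / real K else 0)"
      by (intro sum_mono2) (auto simp: m_def)
    finally show ?thesis .
  qed
  finally show ?thesis .
qed

text \<open>Multiplied by \<open>n\<close>, the sum is \<open>ln (fact n)\<close> plus the
  fractional parts of n / d weighted by \<Lambda> d. Each threshold in their count gives one
  Chebyshev sum. Bounding the fractional parts by 1 would give ln 4 in place of about (ln 4)(ln
  2).\<close>

theorem sum_mangoldt_div_le:
  assumes "n > 0" "K > 0"
  shows "(\<Sum>d=1..n. mangoldt d / real d :: real) \<le>
    ln (real n) - 1 + ln 4 * (\<Sum>j<K. 1 / real (K + j)) + (ln (real n) + 1) / real n"
proof -
  have "real n * (\<Sum>d=1..n. mangoldt d / real d) =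
      ln (fact n) + (\<Sum>d=1..n. mangoldt d * (real n / real d - real (n div d)))"
    by (simp add: ln_fact_eq_sum_mangoldt sum_distrib_left right_diff_distrib sum_subtractf mult.commute)
  also have "(\<Sum>d=1..n. mangoldt d * (real n / real d - real (n div d))) \<le>
      (\<Sum>d=1..n. mangoldt d * (\<Sum>j<K. if d \<le> n * K div (K + j) then 1 / real K else 0))"
    using assms by (intro sum_mono mult_left_mono frac_div_le_count mangoldt_nonneg) auto
  also have "\<dots> = (\<Sum>j<K. \<Sum>d=1..n. if d \<le> n * K div (K + j) then mangoldt d / real K else 0)"
    by (simp add: sum_distrib_left if_distrib sum.swap[of _ _ "{..<K}"] cong: if_cong)
  also have "\<dots> \<le> (\<Sum>j<K. ln 4 * real n * (1 / real (K + j)))"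
  proof (intro sum_mono)
    fix j
    let ?b = "n * K div (K + j)"
    have "?b \<le> n"
      using assms by (metis add_gr_0 div_le_mono div_mult_self_is_m le_add1 mult_le_mono2)
    then have "{d \<in> {1..n}. d \<le> ?b} = {1..?b}"
      by auto
    then have "(\<Sum>d=1..n. if d \<le> ?b then mangoldt d / real K else 0) = (\<Sum>d=1..?b. mangoldt d / real K :: real)"
      using sum.inter_filter[of "{1..n}" "\<lambda>d. mangoldt d / real K :: real" "\<lambda>d. d \<le> ?b"] by simp
    also have "\<dots> \<le> real ?b * ln 4 / real K"
      unfolding sum_divide_distrib[symmetric] by (intro divide_right_mono sum_mangoldt_le) auto
    also have "\<dots> \<le> real (n * K) / real (K + j) * ln 4 / real K"
      by (intro divide_right_mono mult_right_mono of_nat_div_le_of_nat) auto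
    also have "\<dots> = ln 4 * real n * (1 / real (K + j))"
      using assms by (simp del: of_nat_add)
    finally show "(\<Sum>d=1..n. if d \<le> ?b then mangoldt d / real K else 0) \<le> ln 4 * real n * (1 / real (K + j))" .
  qed
  also have "\<dots> = real n * (ln 4 * (\<Sum>j<K. 1 / real (K + j)))"
    by (simp add: sum_distrib_left mult_ac)
  finally have "real n * (\<Sum>d=1..n. mangoldt d / real d) \<le>
      real n * ln (real n) - real n + ln (real n) + 1 + real n * (ln 4 * (\<Sum>j<K. 1 / real (K + j)))"
    using ln_fact_le[of n] assms by linarith
  also have "\<dots> = real n * (ln (real n) - 1 + ln 4 * (\<Sum>j<K. 1 / real (K + j)) + (ln (real n) + 1) / real n)"
    using assms by (simp add: distrib_left right_diff_distrib add_divide_distrib)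
  finally show ?thesis
    using assms by simp
qed

theorem sum_mangoldt_div_ge:
  assumes "n > 0"
  shows "ln (real n) - 1 \<le> (\<Sum>d=1..n. mangoldt d / real d :: real)"
proof -
  have "real n * (ln (real n) - 1) \<le> ln (fact n)"
    using ln_fact_ge[OF assms] by (simp add: algebra_simps)
  also have "\<dots> \<le> (\<Sum>d=1..n. mangoldt d * (real n / real d))"
    unfolding ln_fact_eq_sum_mangoldt by (intro sum_mono mult_left_mono of_nat_div_le_of_nat mangoldt_nonneg)
  also have "\<dots> = real n * (\<Sum>d=1..n. mangoldt d / real d)"
    by (simp add: sum_distrib_left mult.commute)
  finally show ?thesis using assms by simp
qed

text \<open>The value 20 keeps \<^term>\<open>\<Sum>j<20. 1 / real (20 + j)\<close> close enough to its limit \<^term>\<open>ln 2 :: real\<close>.\<close>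
lemma sum_mangoldt_div_le':
  assumes "n > 0"
  shows "(\<Sum>d=1..n. mangoldt d / real d :: real) \<le>
    ln (real n) - 1 + (1412 / 1000) * ln 2 + (ln (real n) + 1) / real n"
proof -
  have "(\<Sum>j<20. 1 / real (20 + j)) \<le> 706 / 1000"
    by (simp add: eval_nat_numeral)
  moreover have "ln (4::real) = 2 * ln 2"
    using ln_realpow[of 2 2] by simp
  ultimately have "ln 4 * (\<Sum>j<20. 1 / real (20 + j)) \<le> (1412 / 1000) * ln 2"
    using mult_left_mono[of "\<Sum>j<20. 1 / real (20 + j)" "706 / 1000" "ln 4"] by simp
  then show ?thesis
    using sum_mangoldt_div_le[OF assms, of 20] by linarith
qed

section \<open>Sums over integers without small prime factors\<close>

definition rough :: "nat \<Rightarrow> nat \<Rightarrow> bool" where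
  "rough p n \<longleftrightarrow> (\<forall>r. prime r \<longrightarrow> r dvd n \<longrightarrow> p \<le> r)"

lemma rough_dvd: "rough p n \<Longrightarrow> d dvd n \<Longrightarrow> rough p d"
  unfolding rough_def by (meson dvd_trans)

lemma rough_imp_eq_1:
  assumes "rough p n" "0 < n" "n < p"
  shows "n = 1"
proof (rule ccontr)
  assume "n \<noteq> 1"
  then obtain r where "prime r" "r dvd n"
    using prime_factor_nat by blast
  then show False
    using assms dvd_imp_le[of r n] unfolding rough_def by (meson leD le_trans)
qed

lemma rough_3_iff: "rough 3 n \<longleftrightarrow> odd n"
proof
  assume "rough 3 n"
  then show "odd n"
    unfolding rough_def using two_is_prime_nat by fastforce
next
  assume n: "odd n"
  show "rough 3 n"
    unfolding rough_def
  proof (intro allI impI)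
    fix r :: nat
    assume "prime r" "r dvd n"
    then show "3 \<le> r"
      using n prime_ge_2_nat[of r] by (cases "r = 2") auto
  qed
qed

text \<open>As \<Lambda> vanishes off prime powers, only powers of primes \<ge> p
  contribute.\<close>

definition rough_sum :: "nat \<Rightarrow> nat \<Rightarrow> real" where
  "rough_sum p m = (\<Sum>q=1..m. if rough p q then mangoldt q / real q else 0)"

lemma rough_sum_le_sum:
  assumes "finite T" "{q \<in> {1..m}. rough p q} \<subseteq> T"
  shows "rough_sum p m \<le> (\<Sum>q\<in>T. mangoldt q / real q)"
proof -
  have "rough_sum p m = (\<Sum>q | q \<in> {1..m} \<and> rough p q. mangoldt q / real q)"
    unfolding rough_sum_def by (subst sum.inter_filter) auto
  also have "\<dots> \<le> (\<Sum>q\<in>T. mangoldt q / real q)"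
    using assms by (intro sum_mono2) (auto intro: divide_nonneg_nonneg mangoldt_nonneg)
  finally show ?thesis .
qed

text \<open>Transfers an upper bound from p to a larger p', with a gain from any explicit set of
  terms that p' excludes.\<close>

lemma sum_add_rough_sum_le:
  assumes "finite T" "T \<subseteq> {q \<in> {1..m}. rough p q \<and> \<not> rough p' q}" "p \<le> p'"
  shows "rough_sum p' m + (\<Sum>q\<in>T. mangoldt q / real q) \<le> rough_sum p m"
proof -
  have "(\<Sum>q\<in>T. mangoldt q / real q) = (\<Sum>q=1..m. if q \<in> T then mangoldt q / real q else 0 :: real)"
    using assms by (subst sum.inter_restrict[symmetric]) (auto intro!: sum.cong)
  then have "rough_sum p' m + (\<Sum>q\<in>T. mangoldt q / real q) =
      (\<Sum>q=1..m. (if rough p' q then mangoldt q / real q else 0) + (if q \<in> T then mangoldt q / real q else 0))"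
    by (simp add: rough_sum_def sum.distrib)
  also have "\<dots> \<le> rough_sum p m"
    unfolding rough_sum_def
  proof (intro sum_mono)
    fix q assume "q \<in> {1..m}"
    have "rough p' q \<Longrightarrow> rough p q"
      using assms(3) by (auto simp: rough_def intro: order_trans)
    moreover have "(0::real) \<le> mangoldt q / real q"
      by (intro divide_nonneg_nonneg mangoldt_nonneg) auto
    ultimately show "(if rough p' q then mangoldt q / real q else 0) + (if q \<in> T then mangoldt q / real q else 0)
        \<le> (if rough p q then mangoldt q / real q else 0)"
      using assms(2) by auto
  qed
  finally show ?thesis .
qed

lemma rough_le_2: "p \<le> 2 \<Longrightarrow> rough p n"
  by (auto simp: rough_def intro: order_trans prime_ge_2_nat)

lemma rough_sum_2: "rough_sum 2 m = (\<Sum>q=1..m. mangoldt q / real q)"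
  by (simp add: rough_sum_def rough_le_2)

section \<open>Numerical logarithms as rational multiples of ln 2\<close>

lemma ln_le_mult_ln_2:
  assumes "0 < x" "0 < a" "x ^ a \<le> 2 ^ b"
  shows "ln (x :: real) \<le> real b / real a * ln 2"
proof -
  have "real a * ln x = ln (x ^ a)" "real b * ln 2 = ln (2 ^ b)"
    using assms by (simp_all add: ln_realpow)
  moreover have "ln (x ^ a) \<le> ln (2 ^ b)"
    using assms by (intro ln_mono) auto
  ultimately show ?thesis
    using assms by (simp add: field_simps)
qed

lemma ln_ge_mult_ln_2:
  assumes "0 < x" "0 < a" "2 ^ b \<le> x ^ a"
  shows "real b / real a * ln 2 \<le> ln (x :: real)"
proof -
  have "real a * ln x = ln (x ^ a)" "real b * ln 2 = ln (2 ^ b)"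
    using assms by (simp_all add: ln_realpow)
  moreover have "ln (2 ^ b) \<le> ln (x ^ a)"
    using assms by (intro ln_mono) auto
  ultimately show ?thesis
    using assms by (simp add: field_simps)
qed

text \<open>Each fraction encodes an integer inequality such as 3^17 \<le> 2^27. Later estimates
  thereby become linear in the single unknown ln 2.\<close>

lemma ln_upper_bounds:
  "ln (3::real) \<le> 27/17 * ln 2" "ln (5::real) \<le> 7/3 * ln 2" "ln (7::real) \<le> 17/6 * ln 2"
  "ln (11::real) \<le> 7/2 * ln 2" "ln (13::real) \<le> 15/4 * ln 2" "ln (17::real) \<le> 17/4 * ln 2"
  "ln (19::real) \<le> 17/4 * ln 2" "ln (23::real) \<le> 23/5 * ln 2" "ln (29::real) \<le> 5 * ln 2"
  "ln (31::real) \<le> 5 * ln 2"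
  using ln_le_mult_ln_2[of 3 17 27] ln_le_mult_ln_2[of 5 3 7] ln_le_mult_ln_2[of 7 6 17]
    ln_le_mult_ln_2[of 11 2 7] ln_le_mult_ln_2[of 13 4 15] ln_le_mult_ln_2[of 17 4 17]
    ln_le_mult_ln_2[of 19 4 17] ln_le_mult_ln_2[of 23 5 23] ln_le_mult_ln_2[of 29 1 5]
    ln_le_mult_ln_2[of 31 1 5]
  by simp_all

lemma ln_lower_bounds:
  "19/12 * ln 2 \<le> ln (3::real)" "16/7 * ln 2 \<le> ln (5::real)" "11/3 * ln 2 \<le> ln (13::real)"
  "49/12 * ln 2 \<le> ln (17::real)" "17/4 * ln 2 \<le> ln (20::real)" "5/2 * ln 2 \<le> ln (7::real)"
  using ln_ge_mult_ln_2[of 3 12 19] ln_ge_mult_ln_2[of 5 7 16] ln_ge_mult_ln_2[of 13 3 11]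
    ln_ge_mult_ln_2[of 17 12 49] ln_ge_mult_ln_2[of 20 4 17] ln_ge_mult_ln_2[of 7 2 5]
  by simp_all

lemma mangoldt_small:
  "mangoldt 2 = (ln 2 :: real)" "mangoldt 3 = (ln 3 :: real)" "mangoldt 4 = (ln 2 :: real)" "mangoldt 5 = (ln 5 :: real)"
  "mangoldt 7 = (ln 7 :: real)" "mangoldt 8 = (ln 2 :: real)" "mangoldt 9 = (ln 3 :: real)" "mangoldt 11 = (ln 11 :: real)"
  "mangoldt 13 = (ln 13 :: real)" "mangoldt 15 = (0 :: real)" "mangoldt 16 = (ln 2 :: real)" "mangoldt 17 = (ln 17 :: real)"
  "mangoldt 19 = (ln 19 :: real)" "mangoldt 21 = (0 :: real)" "mangoldt 23 = (ln 23 :: real)" "mangoldt 25 = (ln 5 :: real)"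
  "mangoldt 27 = (ln 3 :: real)" "mangoldt 29 = (ln 29 :: real)" "mangoldt 31 = (ln 31 :: real)" "mangoldt 32 = (ln 2 :: real)"
proof -
  have "\<not> primepow (15::nat)" "\<not> primepow (21::nat)"
    using not_primepowI[of 3 5 "15::nat"] not_primepowI[of 3 7 "21::nat"] by simp_all
  then show "mangoldt 15 = (0 :: real)" "mangoldt 21 = (0 :: real)"
    by (simp_all add: mangoldt_def)
qed (use mangoldt_primepow'[of 2 2, where ?'a = real] mangoldt_primepow'[of 2 3, where ?'a = real]
      mangoldt_primepow'[of 2 4, where ?'a = real] mangoldt_primepow'[of 2 5, where ?'a = real]
      mangoldt_primepow'[of 3 2, where ?'a = real] mangoldt_primepow'[of 3 3, where ?'a = real]
      mangoldt_primepow'[of 5 2, where ?'a = real] in simp_all)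

section \<open>Mertens bound for rough sums\<close>

lemma rough_sum_3_le_sum:
  assumes "m \<le> 2 * K"
  shows "rough_sum 3 m \<le> (\<Sum>k<K. mangoldt (2 * k + 1) / real (2 * k + 1))"
proof -
  have "{q \<in> {1..m}. rough 3 q} \<subseteq> (\<lambda>k. 2 * k + 1) ` {..<K}"
    using assms by (auto simp: rough_3_iff elim!: oddE)
  from rough_sum_le_sum[OF _ this] show ?thesis
    by (simp add: sum.reindex inj_on_def)
qed

text \<open>On each of five ranges the sum is replaced by its value at the upper end and ln m by a
  lower bound valid from the lower end; the ranges are short enough for this to suffice.\<close>

lemma rough_sum_3_small:
  assumes "3 \<le> m" "m < 32"
  shows "rough_sum 3 m \<le> ln (real m) - ln 3 / 2"
proof -
  note ub = ln_upper_bounds and lb = ln_lower_bounds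
  have ln2: "ln (2::real) > 0" by simp
  consider "m \<le> 4" | "5 \<le> m" "m \<le> 8" | "9 \<le> m" "m \<le> 12" | "13 \<le> m" "m \<le> 19" | "20 \<le> m" "m \<le> 31"
    using assms by linarith
  then show ?thesis
  proof cases
    case 1
    have "rough_sum 3 m \<le> ln 3 / 3"
      using rough_sum_3_le_sum[of m 2] 1 by (simp add: lessThan_nat_numeral mangoldt_small)
    moreover have "ln 3 \<le> ln (real m)"
      using 1 assms by simp
    ultimately show ?thesis
      using lb ub ln2 by linarith
  next
    case 2
    have "rough_sum 3 m \<le> ln 3 / 3 + ln 5 / 5 + ln 7 / 7"
      using rough_sum_3_le_sum[of m 4] 2 by (simp add: lessThan_nat_numeral mangoldt_small)
    moreover have "ln 5 \<le> ln (real m)"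
      using 2 assms by simp
    ultimately show ?thesis
      using lb ub ln2 by linarith
  next
    case 3
    have "rough_sum 3 m \<le> ln 3 / 3 + ln 5 / 5 + ln 7 / 7 + ln 3 / 9 + ln 11 / 11"
      using rough_sum_3_le_sum[of m 6] 3 by (simp add: lessThan_nat_numeral mangoldt_small)
    moreover have "ln 9 \<le> ln (real m)"
      using 3 assms by simp
    moreover have "ln (9::real) = 2 * ln 3"
      using ln_realpow[of 3 2] by simp
    ultimately show ?thesis
      using lb ub ln2 by linarith
  next
    case 4
    have "rough_sum 3 m \<le> ln 3 / 3 + ln 5 / 5 + ln 7 / 7 + ln 3 / 9 + ln 11 / 11 + ln 13 / 13 + ln 17 / 17 + ln 19 / 19"
      using rough_sum_3_le_sum[of m 10] 4 by (simp add: lessThan_nat_numeral mangoldt_small)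
    moreover have "ln 13 \<le> ln (real m)"
      using 4 assms by simp
    ultimately show ?thesis
      using lb ub ln2 by linarith
  next
    case 5
    have "rough_sum 3 m \<le> ln 3 / 3 + ln 5 / 5 + ln 7 / 7 + ln 3 / 9 + ln 11 / 11 + ln 13 / 13 + ln 17 / 17 + ln 19 / 19 + ln 23 / 23 + ln 5 / 25
        + ln 3 / 27 + ln 29 / 29 + ln 31 / 31"
      using rough_sum_3_le_sum[of m 16] 5 by (simp add: lessThan_nat_numeral mangoldt_small)
    moreover have "ln 20 \<le> ln (real m)"
      using 5 assms by simp
    ultimately show ?thesis
      using lb ub ln2 by linarith
  qed
qed

lemma rough_sum_3_large:
  assumes "32 \<le> m"
  shows "rough_sum 3 m \<le> ln (real m) - ln 3 / 2"
proof -
  have "{2, 4, 8, 16, 32} \<subseteq> {q \<in> {1..m}. rough 2 q \<and> \<not> rough 3 q}"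
    using assms by (auto simp: rough_3_iff rough_le_2)
  from sum_add_rough_sum_le[OF _ this]
  have "rough_sum 3 m + 31/32 * ln 2 \<le> (\<Sum>q=1..m. mangoldt q / real q)"
    by (simp add: mangoldt_small rough_sum_2)
  moreover have "(\<Sum>q=1..m. mangoldt q / real q :: real) \<le>
      ln (real m) - 1 + (1412 / 1000) * ln 2 + (ln (real m) + 1) / real m"
    using assms by (intro sum_mangoldt_div_le') auto
  \<comment> \<open>The function (ln t + 1) / t decreases for t \<ge> 1; this is its value at
    32.\<close>
  moreover have "(ln (real m) + 1) / real m \<le> 1/32 + 5/32 * ln 2"
  proof -
    have "ln (real m / 32) \<le> real m / 32 - 1"
      using assms by (intro ln_le_minus_one) auto
    moreover have "ln (32::real) = 5 * ln 2"
      using ln_realpow[of 2 5] by simp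
    ultimately have "ln (real m) + 1 \<le> real m / 32 + 5 * ln 2"
      using assms by (simp add: ln_div)
    also have "5 * ln 2 \<le> real m / 32 * (5 * ln (2::real))"
      using assms by (intro mult_le_cancel_right1[THEN iffD2]) auto
    finally show ?thesis
      using assms by (simp add: field_simps)
  qed
  \<comment> \<open>What remains needs ln 2 below about 0.6951; 25/36 is just small enough.\<close>
  ultimately show ?thesis
    using ln_upper_bounds(1) ln2_le_25_over_36 by linarith
qed

lemma rough_sum_3_le: "3 \<le> m \<Longrightarrow> rough_sum 3 m \<le> ln (real m) - ln 3 / 2"
  using rough_sum_3_small rough_sum_3_large by (cases "m < 32") auto

text \<open>The full sum up to m minus the full sum below p: the upper Mertens bound at m against
  the lower one at p, corrected by the term ln p / p.\<close>

lemma rough_sum_large_le: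
  assumes p: "prime p" "17 \<le> p" and "p \<le> m"
  shows "rough_sum p m \<le> ln (real m) - ln (real p) / 2"
proof -
  have "rough_sum p m + (\<Sum>q=1..p - 1. mangoldt q / real q) \<le> (\<Sum>q=1..m. mangoldt q / real q)"
  proof -
    let ?T = "{q \<in> {1..p - 1}. \<not> rough p q}"
    have "?T \<subseteq> {q \<in> {1..m}. rough 2 q \<and> \<not> rough p q}"
      using assms by (auto simp: rough_le_2)
    then have "rough_sum p m + (\<Sum>q\<in>?T. mangoldt q / real q) \<le> rough_sum 2 m"
      using p by (intro sum_add_rough_sum_le) auto
    moreover have "(\<Sum>q\<in>?T. mangoldt q / real q) = (\<Sum>q=1..p - 1. mangoldt q / real q :: real)"
    proof (intro sum.mono_neutral_left ballI)
      \<comment> \<open>Below p only q = 1 is rough, and \<Lambda> 1 = 0.\<close>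
      fix q assume q: "q \<in> {1..p - 1} - ?T"
      then have "rough p q" "0 < q" "q < p"
        using p by auto
      then show "mangoldt q / real q = (0::real)"
        using rough_imp_eq_1[of p q] by simp
    qed auto
    ultimately show ?thesis by (simp add: rough_sum_2)
  qed
  moreover have "(\<Sum>q=1..p. mangoldt q / real q :: real) = (\<Sum>q=1..p - 1. mangoldt q / real q) + ln (real p) / real p"
    using p by (cases p) auto
  moreover have "ln (real p) - 1 \<le> (\<Sum>q=1..p. mangoldt q / real q :: real)"
    using p by (intro sum_mangoldt_div_ge) auto
  moreover have "(\<Sum>q=1..m. mangoldt q / real q :: real) \<le>
      ln (real m) - 1 + (1412 / 1000) * ln 2 + (ln (real m) + 1) / real m"
    using assms by (intro sum_mangoldt_div_le') auto
  moreover have "(ln (real m) + 1) / real m \<le> (ln (real p) + 1) / real p"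
  proof -
    have "ln (real m / real p) \<le> real m / real p - 1"
      using assms by (intro ln_le_minus_one) auto
    then have "ln (real m) + 1 \<le> real m / real p + ln (real p)"
      using assms by (simp add: ln_div)
    also have "ln (real p) \<le> real m / real p * ln (real p)"
      using assms by (intro mult_le_cancel_right1[THEN iffD2]) auto
    finally show ?thesis
      using assms by (simp add: field_simps)
  qed
  \<comment> \<open>This fails at 13, hence the threshold 17. Replacing the denominator p by 17
    leaves an inequality linear in ln p.\<close>
  moreover have "(1412 / 1000) * ln 2 + (2 * ln (real p) + 1) / real p \<le> ln (real p) / 2"
  proof -
    have "ln (17::real) \<le> ln (real p)"
      using p by simp
    then have ln_p: "49/12 * ln 2 \<le> ln (real p)"
      using ln_lower_bounds(4) by linarith
    have "(2 * ln (real p) + 1) / real p \<le> (2 * ln (real p) + 1) / 17"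
      using p by (intro divide_left_mono) (auto intro: add_nonneg_pos)
    also have "\<dots> \<le> ln (real p) / 2 - (1412 / 1000) * ln 2"
      using ln_p ln2_ge_two_thirds by simp
    finally show ?thesis by linarith
  qed
  ultimately show ?thesis
    by (simp add: add_divide_distrib)
qed

theorem rough_sum_le:
  assumes p: "prime p" "2 < p" and m: "p \<le> m"
  shows "rough_sum p m \<le> ln (real m) - ln (real p) / 2"
proof -
  \<comment> \<open>The bound for 3 yields that for p once the removed terms T pay for the
    difference (ln p - ln 3) / 2.\<close>
  have *: ?thesis
    if "T \<subseteq> {3, 5, 7}" "\<And>q. q \<in> T \<Longrightarrow> q < p" "ln (real p) \<le> ln 3 + 2 * (\<Sum>q\<in>T. mangoldt q / real q)" for T
  proof -
    have "finite T" using that(1) by (rule finite_subset) auto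
    moreover have "T \<subseteq> {q \<in> {1..m}. rough 3 q \<and> \<not> rough p q}"
    proof
      fix q assume q: "q \<in> T"
      then have "q \<in> {3, 5, 7}" "q < p"
        using that by auto
      moreover from this have "\<not> rough p q"
        using rough_imp_eq_1[of p q] by auto
      ultimately show "q \<in> {q \<in> {1..m}. rough 3 q \<and> \<not> rough p q}"
        using m by (auto simp: rough_3_iff)
    qed
    ultimately have "rough_sum p m + (\<Sum>q\<in>T. mangoldt q / real q) \<le> rough_sum 3 m"
      using p by (intro sum_add_rough_sum_le) auto
    then show ?thesis
      using rough_sum_3_le[of m] that(3) p m by simp
  qed
  have "p < 17 \<Longrightarrow> p = 3 \<or> p = 5 \<or> p = 7 \<or> p = 11 \<or> p = 13"
  proof -
    assume "p < 17"
    moreover obtain k where k: "p = 2 * k + 1"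
      using prime_odd_nat[of p] p by (auto elim: oddE)
    ultimately have "k \<in> {..<8}" by simp
    then show ?thesis
      using p k by (auto simp: lessThan_nat_numeral)
  qed
  then consider "17 \<le> p" | "p = 3" | "p = 5" | "p = 7" | "p = 11" | "p = 13"
    by linarith
  then show ?thesis
  proof cases
    case 1
    then show ?thesis using rough_sum_large_le p m by blast
  next
    case 2
    then show ?thesis using *[of "{}"] by simp
  next
    case 3
    then show ?thesis
      using ln_upper_bounds ln_lower_bounds by (intro *[of "{3}"]) (auto simp: mangoldt_small)
  next
    case 4
    then show ?thesis
      using ln_upper_bounds ln_lower_bounds by (intro *[of "{3, 5}"]) (auto simp: mangoldt_small)
  next
    case 5
    then show ?thesis
      using ln_upper_bounds ln_lower_bounds by (intro *[of "{3, 5}"]) (auto simp: mangoldt_small)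
  next
    case 6
    then show ?thesis
      using ln_upper_bounds ln_lower_bounds by (intro *[of "{3, 5, 7}"]) (auto simp: mangoldt_small)
  qed
qed

section \<open>Partial summation\<close>

text \<open>The difference of the two sides is 0 at 1 and has derivative (1 - 1 / y)^2 / 2.\<close>

lemma ln_le_half_diff_inverse:
  assumes "1 \<le> (y::real)"
  shows "ln y \<le> (y - 1 / y) / 2"
proof -
  define g where "g = (\<lambda>y::real. (y - 1 / y) / 2 - ln y)"
  have "g 1 \<le> g y"
  proof (rule DERIV_nonneg_imp_nondecreasing[OF assms])
    fix x :: real assume x: "1 \<le> x"
    have "(g has_real_derivative (1 + 1 / x\<^sup>2) / 2 - 1 / x) (at x)"
      unfolding g_def using x
      by (auto intro!: derivative_eq_intros simp: power2_eq_square field_simps)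
    moreover have "(1 + 1 / x\<^sup>2) / 2 - 1 / x = (1 - 1 / x)\<^sup>2 / 2"
      using x by (simp add: power2_eq_square field_simps)
    ultimately show "\<exists>d. (g has_real_derivative d) (at x) \<and> d \<ge> 0"
      by (metis zero_le_power2 divide_nonneg_pos zero_less_numeral)
  qed
  then show ?thesis by (simp add: g_def)
qed

text \<open>The right side is the integral of 1 / (t (t + l)) from a to b, the left side the
  interval length times the smallest value of the integrand. Integration is avoided by using ln z
  \<le> z - 1.\<close>

lemma diff_over_product_le:
  fixes a b l :: real
  assumes "0 < a" "a \<le> b" "0 < l"
  shows "(b - a) / (b * (b + l)) \<le> (ln ((a + l) / a) - ln ((b + l) / b)) / l"
proof -
  let ?z = "a * (b + l) / ((a + l) * b)"
  have pos: "0 < b" "0 < a + l" "0 < b + l" using assms by auto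
  have "l * ((b - a) / (b * (b + l))) \<le> l * ((b - a) / (b * (a + l)))"
    using assms pos by (intro mult_left_mono divide_left_mono) auto
  also have "\<dots> = ((a + l) * b - a * (b + l)) / ((a + l) * b)"
    by (simp add: algebra_simps)
  also have "\<dots> = 1 - ?z"
    using pos by (simp add: diff_divide_distrib)
  also have "\<dots> \<le> - ln ?z"
    using ln_le_minus_one[of ?z] assms pos by simp
  also have "\<dots> = ln ((a + l) / a) - ln ((b + l) / b)"
    using assms pos by (simp add: ln_div ln_mult)
  finally show ?thesis
    using assms by (simp add: field_simps)
qed

text \<open>
  Summation by parts against \<open>u \<mapsto> 1 / ((x + u) (x + u - l))\<close> with \<open>l = ln p\<close>, whose integral over
  \<open>u \<ge> l\<close> is \<open>ln ((x + l) / x) / l\<close>. The error term \<open>- l / 2\<close> in the hypothesis on the partial sums is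
  exactly what makes the result at most \<open>1 / x\<close>.
\<close>
lemma sum_over_ln_product_le:
  fixes a :: "nat \<Rightarrow> real" and x :: real
  assumes nonneg: "\<And>q. 0 \<le> a q" and zero: "\<And>q. q < p \<Longrightarrow> a q = 0"
    and le: "\<And>m. p \<le> m \<Longrightarrow> (\<Sum>q=1..m. a q) \<le> ln (real m) - ln (real p) / 2"
    and p: "1 < p" and x: "0 < x"
  shows "(\<Sum>q=1..M. a q / ((x + ln (real q)) * (x + ln (real q) - ln (real p)))) \<le> 1 / x"
proof -
  define l where "l = ln (real p)"
  define g where "g = (\<lambda>q. 1 / ((x + ln (real q)) * (x + ln (real q) - l)))"
  \<comment> \<open>\<open>H q\<close> is the integral of 1 / ((x + u) (x + u - l)) over u \<ge> ln
    q.\<close>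
  define H where "H = (\<lambda>q. ln ((x + ln (real q)) / (x + ln (real q) - l)) / l)"
  define S where "S = (\<lambda>m. \<Sum>q=1..m. a q)"
  define B where "B = (\<lambda>m::nat. ln (real m) - l / 2)"
  have l: "0 < l" using p by (simp add: l_def)
  have ln_ge: "l \<le> ln (real q)" if "p \<le> q" for q
    using that p by (simp add: l_def)
  have sum_p: "(\<Sum>q=1..p. a q * c q) = a p * c p" for c :: "nat \<Rightarrow> real"
  proof -
    have "(\<Sum>q=1..p. a q * c q) = (\<Sum>q=1..p - 1. a q * c q) + a p * c p"
      using p by (cases p) auto
    also have "(\<Sum>q=1..p - 1. a q * c q) = 0"
      using p zero by (intro sum.neutral) auto
    finally show ?thesis by simp
  qed
  have S_p: "S p = a p"
    using sum_p[of "\<lambda>_. 1"] by (simp add: S_def)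
  \<comment> \<open>Summation by parts as an invariant, with \<open>B - S\<close> the slack in the
    hypothesis. Equality holds at \<open>m = p\<close>; each step uses that \<open>g\<close>
    decreases and that \<open>H\<close> drops by at least the new term of the integral.\<close>
  have main: "(\<Sum>q=1..m. a q * g q) \<le> B p * g p + H p - H m - (B m - S m) * g m" if "p \<le> m" for m
    using that
  proof (induction m rule: dec_induct)
    case base
    show ?case unfolding S_p sum_p by (simp add: algebra_simps)
  next
    case (step m)
    let ?u = "ln (real m)" and ?v = "ln (real (Suc m))"
    have uv: "l \<le> ?u" "?u \<le> ?v" using step.hyps p ln_ge by auto
    have "(?v - ?u) * g (Suc m) \<le> H m - H (Suc m)"
      using diff_over_product_le[of "x + ?u - l" "x + ?v - l" l] uv x l
      by (simp add: g_def H_def diff_divide_distrib mult.commute)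
    moreover have "0 \<le> (B m - S m) * (g m - g (Suc m))"
    proof (intro mult_nonneg_nonneg)
      show "0 \<le> B m - S m"
        using le[of m] step.hyps by (simp add: B_def S_def l_def)
      have "(x + ?u) * (x + ?u - l) \<le> (x + ?v) * (x + ?v - l)"
        using uv x l by (intro mult_mono) auto
      then show "0 \<le> g m - g (Suc m)"
        unfolding g_def using uv x l by (simp add: frac_le)
    qed
    moreover have "(B (Suc m) - S (Suc m)) * g (Suc m) =
        (B m - S m) * g (Suc m) + (?v - ?u) * g (Suc m) - a (Suc m) * g (Suc m)"
      by (simp add: B_def S_def algebra_simps del: of_nat_Suc)
    moreover have "(\<Sum>q=1..Suc m. a q * g q) = (\<Sum>q=1..m. a q * g q) + a (Suc m) * g (Suc m)"
      by simp
    ultimately show ?case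
      using step.IH by (simp only: right_diff_distrib)
  qed
  \<comment> \<open>As \<open>B p = l / 2\<close>, the boundary term is l / (2 x (x + l)), exactly
    the gap that the bound on ln y leaves below 1 / x.\<close>
  have bound: "B p * g p + H p \<le> 1 / x"
  proof -
    let ?y = "(x + l) / x"
    have "ln ?y \<le> (?y - 1 / ?y) / 2"
      using x l by (intro ln_le_half_diff_inverse) auto
    then have "ln ?y / l \<le> (?y - 1 / ?y) / 2 / l"
      using l by (intro divide_right_mono) auto
    moreover have "(?y - 1 / ?y) / 2 / l = 1 / x - l / 2 / ((x + l) * x)"
      using x l by (simp add: divide_simps add_pos_pos) (simp add: algebra_simps)
    moreover have "B p * g p + H p = l / 2 / ((x + l) * x) + ln ?y / l"
      by (simp add: B_def g_def H_def l_def[symmetric])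
    ultimately show ?thesis by linarith
  qed
  have "(\<Sum>q=1..M. a q * g q) \<le> 1 / x"
  proof (cases "p \<le> M")
    case True
    have "0 \<le> H M"
      using ln_ge[OF True] x l by (auto simp: H_def intro!: divide_nonneg_pos)
    moreover have "0 \<le> (B M - S M) * g M"
    proof (intro mult_nonneg_nonneg)
      show "0 \<le> B M - S M"
        using le[OF True] by (simp add: B_def S_def l_def)
      show "0 \<le> g M"
        using ln_ge[OF True] x l by (simp add: g_def)
    qed
    ultimately show ?thesis
      using main[OF True] bound by linarith
  next
    case False
    then have "(\<Sum>q=1..M. a q * g q) = 0"
      using zero by (intro sum.neutral) auto
    then show ?thesis using x by simp
  qed
  then show ?thesis by (simp add: g_def l_def)
qed

section \<open>Transport of mass along divisors\<close>

text \<open>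
  The inflow into \<open>k \<in> A\<close> is replaced by \<open>w k\<close>: this makes \<open>mass \<le> w\<close> an immediate induction, and
  nothing is lost when \<open>A\<close> is an antichain, because the inflow there is 0.
\<close>
function mass :: "nat set \<Rightarrow> nat \<Rightarrow> nat set \<Rightarrow> (nat \<Rightarrow> real) \<Rightarrow> nat \<Rightarrow> real" where
  "mass R N A w k = (if k \<in> A then w k else
     (\<Sum>m | m \<in> R \<and> m \<le> N \<and> k < m \<and> k dvd m. mass R N A w m * mangoldt (m div k) / ln (real m)))"
  by auto
termination
  by (relation "Wellfounded.measure (\<lambda>(R, N, A, w, k). N - k)") auto

declare mass.simps [simp del]

text \<open>This makes \<Lambda> (m / k) / ln m a probability distribution on the proper divisors k
  of m > 1; k = m would contribute \<Lambda> 1 = 0.\<close>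

lemma sum_mangoldt_proper_quotients:
  assumes "0 < m"
  shows "(\<Sum>k | k dvd m \<and> k < m. mangoldt (m div k)) = ln (real m)"
proof -
  have "(\<Sum>k | k dvd m \<and> k < m. mangoldt (m div k)) = (\<Sum>k | k dvd m. mangoldt (m div k) :: real)"
  proof (intro sum.mono_neutral_left ballI)
    fix k assume "k \<in> {k. k dvd m} - {k. k dvd m \<and> k < m}"
    then have "k = m" using assms dvd_imp_le[of k m] by auto
    then show "mangoldt (m div k) = (0 :: real)" using assms by simp
  qed (use assms in auto)
  also have "\<dots> = (\<Sum>d | d dvd m. mangoldt d)"
    using assms by (intro sum.reindex_bij_witness[of _ "\<lambda>d. m div d" "\<lambda>d. m div d"]) auto
  also have "\<dots> = ln (real m)"
    using assms by (subst mangoldt_sum) auto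
  finally show ?thesis .
qed

text \<open>\<open>h\<close> is the mass flowing down from sources \<open>w\<close> on
  \<open>A\<close>. Every point but 1 passes on all it holds, so for N \<ge> 1 adding up inflow and
  outflow leaves \<open>sum w A = h 1\<close>, while \<open>sub\<close> keeps \<open>h\<close> below
  \<open>w\<close>.\<close>

lemma sum_antichain_le:
  fixes R A :: "nat set" and w :: "nat \<Rightarrow> real"
  assumes "0 \<notin> R" "1 \<in> R" and closed: "\<And>m d. m \<in> R \<Longrightarrow> d dvd m \<Longrightarrow> d \<in> R"
    and w: "\<And>k. k \<in> R \<Longrightarrow> 0 \<le> w k"
    and A: "A \<subseteq> R" "A \<subseteq> {..N}" and antichain: "\<And>a b. a \<in> A \<Longrightarrow> b \<in> A \<Longrightarrow> a dvd b \<Longrightarrow> a = b"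
    and sub: "\<And>k. k \<in> R \<Longrightarrow>
      (\<Sum>m | m \<in> R \<and> m \<le> N \<and> k < m \<and> k dvd m. w m * mangoldt (m div k) / ln (real m)) \<le> w k"
  shows "sum w A \<le> w 1"
proof -
  define h where "h = mass R N A w"
  define up where "up = (\<lambda>k. {m. m \<in> R \<and> m \<le> N \<and> k < m \<and> k dvd m})"
  define J where "J = (\<lambda>k. \<Sum>m\<in>up k. h m * mangoldt (m div k) / ln (real m))"
  define D where "D = {k \<in> R. k \<le> N}"
  have h_eq: "h k = (if k \<in> A then w k else J k)" for k
    unfolding h_def J_def up_def by (subst mass.simps) simp
  have fin: "finite (up k)" "finite D" for k
    by (auto simp: up_def D_def)
  have pos: "0 < m" if "m \<in> R" for m
    using that assms(1) by (metis gr0I)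
  have h_bounds: "0 \<le> h k \<and> h k \<le> w k" if "k \<in> R" for k
    using that
  proof (induction "N - k" arbitrary: k rule: less_induct)
    case less
    have IH: "0 \<le> h m \<and> h m \<le> w m" if "m \<in> up k" for m
      using that by (intro less.hyps) (auto simp: up_def)
    have ln_nonneg: "0 \<le> ln (real m)" if "m \<in> up k" for m
      using that by (intro ln_ge_zero) (auto simp: up_def)
    have "0 \<le> J k"
      unfolding J_def using IH ln_nonneg
      by (intro sum_nonneg divide_nonneg_nonneg mult_nonneg_nonneg mangoldt_nonneg) auto
    moreover have "J k \<le> (\<Sum>m\<in>up k. w m * mangoldt (m div k) / ln (real m))"
      unfolding J_def using IH ln_nonneg
      by (intro sum_mono divide_right_mono mult_right_mono mangoldt_nonneg) auto
    ultimately show ?case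
      using sub[OF less.prems] w[OF less.prems] by (auto simp: h_eq up_def)
  qed
  \<comment> \<open>A point with no multiple in \<open>A\<close> receives nothing, by induction
    downwards from \<open>N\<close>.\<close>
  have h_zero: "h m = 0" if "\<And>a. a \<in> A \<Longrightarrow> \<not> m dvd a" for m
    using that
  proof (induction "N - m" arbitrary: m rule: less_induct)
    case less
    have "h m' = 0" if "m' \<in> up m" for m'
      using that less.prems by (intro less.hyps) (auto simp: up_def intro: dvd_trans)
    then show ?case
      using less.prems[of m] by (auto simp: h_eq J_def)
  qed
  \<comment> \<open>For k in \<open>A\<close>, a proper multiple carrying mass would divide an
    element of \<open>A\<close> that k divides too, against the antichain property. So the override
    in \<open>mass\<close> amounts to adding \<open>w k\<close> to inflow 0.\<close>
  have "h k = (if k \<in> A then w k else 0) + J k" for k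
  proof (cases "k \<in> A")
    case True
    have "h m = 0" if m: "m \<in> up k" for m
    proof (rule h_zero)
      fix a assume "a \<in> A"
      show "\<not> m dvd a"
      proof
        assume "m dvd a"
        with m have "k dvd a" by (auto simp: up_def intro: dvd_trans)
        with \<open>a \<in> A\<close> True have "k = a" by (intro antichain)
        with m \<open>m dvd a\<close> show False
          using pos[of k] True A dvd_imp_le[of m k] by (auto simp: up_def)
      qed
    qed
    then show ?thesis using True by (simp add: h_eq J_def)
  qed (simp add: h_eq)
  then have "sum h D = (\<Sum>k\<in>D. if k \<in> A then w k else 0) + sum J D"
    by (simp add: sum.distrib)
  also have "(\<Sum>k\<in>D. if k \<in> A then w k else 0) = sum w A"
    using A fin by (subst sum.inter_restrict[symmetric]) (auto simp: D_def intro!: sum.cong)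
  also have "sum J D = (\<Sum>m\<in>D. \<Sum>k | k \<in> D \<and> m \<in> up k. h m * mangoldt (m div k) / ln (real m))"
  proof -
    have "sum J D = (\<Sum>k\<in>D. \<Sum>m | m \<in> D \<and> m \<in> up k. h m * mangoldt (m div k) / ln (real m))"
      unfolding J_def by (intro sum.cong) (auto simp: up_def D_def)
    also have "\<dots> = (\<Sum>m\<in>D. \<Sum>k | k \<in> D \<and> m \<in> up k. h m * mangoldt (m div k) / ln (real m))"
      by (rule sum.swap_restrict[OF fin(2) fin(2)])
    finally show ?thesis .
  qed
  \<comment> \<open>Outflow: all proper divisors of m lie in \<open>D\<close> since \<open>R\<close>
    is closed, and their weights add up to 1; m = 1 has none.\<close>
  also have "\<dots> = (\<Sum>m\<in>D - {1}. h m)"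
  proof -
    have inner: "(\<Sum>k | k \<in> D \<and> m \<in> up k. h m * mangoldt (m div k) / ln (real m)) = (if m = 1 then 0 else h m)"
      if m: "m \<in> D" for m
    proof -
      have "0 < m" using pos m by (auto simp: D_def)
      have "{k. k \<in> D \<and> m \<in> up k} = {k. k dvd m \<and> k < m}"
        using m closed by (auto simp: D_def up_def)
      then have "(\<Sum>k | k \<in> D \<and> m \<in> up k. h m * mangoldt (m div k) / ln (real m)) = h m / ln (real m) * ln (real m)"
        using sum_mangoldt_proper_quotients[OF \<open>0 < m\<close>]
        by (simp flip: sum_distrib_left sum_divide_distrib)
      then show ?thesis
        using \<open>0 < m\<close> by auto
    qed
    have "(\<Sum>m\<in>D - {1}. h m) = (\<Sum>m\<in>D. if m = 1 then 0 else h m)"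
      using fin by (intro sum.mono_neutral_cong_left) auto
    then show ?thesis
      using inner by simp
  qed
  finally have "sum h D - sum h (D - {1}) = sum w A" by simp
  \<comment> \<open>If 1 is not in \<open>D\<close>, then \<open>N = 0\<close> and the difference is
    0.\<close>
  moreover have "sum h D - sum h (D - {1}) \<le> w 1"
    using fin h_bounds[OF assms(2)] w[OF assms(2)] by (cases "1 \<in> D") (simp_all add: sum.remove[of D 1])
  ultimately show ?thesis by simp
qed

section \<open>Primitive sets\<close>

lemma sum_rough_over_ln_product_le:
  assumes p: "prime p" "2 < p" and x: "0 < x"
  shows "(\<Sum>q | q \<in> {1..M} \<and> rough p q.
      mangoldt q / (real q * (x + ln (real q)) * (x + ln (real q) - ln (real p)))) \<le> 1 / x"
proof -
  define a where "a = (\<lambda>q. if 0 < q \<and> rough p q then mangoldt q / real q else 0 :: real)"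
  have sum_a: "(\<Sum>q=1..m. a q) = rough_sum p m" for m
    unfolding rough_sum_def a_def by (intro sum.cong) auto
  have "(\<Sum>q=1..M. a q / ((x + ln (real q)) * (x + ln (real q) - ln (real p)))) \<le> 1 / x"
  proof (rule sum_over_ln_product_le)
    show "0 \<le> a q" for q
      by (auto simp: a_def intro: divide_nonneg_nonneg mangoldt_nonneg)
    show "a q = 0" if "q < p" for q
      using rough_imp_eq_1[of p q] that by (auto simp: a_def)
    show "(\<Sum>q=1..m. a q) \<le> ln (real m) - ln (real p) / 2" if "p \<le> m" for m
      unfolding sum_a using rough_sum_le p that by blast
  qed (use p x in auto)
  also have "(\<Sum>q=1..M. a q / ((x + ln (real q)) * (x + ln (real q) - ln (real p)))) =
      (\<Sum>q | q \<in> {1..M} \<and> rough p q. mangoldt q / (real q * (x + ln (real q)) * (x + ln (real q) - ln (real p))))"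
    by (intro sum.mono_neutral_cong_right) (auto simp: a_def)
  finally show ?thesis .
qed

text \<open>With m = k q and x = ln (p k), one has ln (p m) = x + ln q and ln m = x + ln q - ln p,
  so the inflow is 1 / (p k) times part of the sum bounded by 1 / x.\<close>

lemma rough_multiple_flow_le:
  assumes p: "prime p" "2 < p" and k: "0 < k" "rough p k"
  shows "(\<Sum>m | m \<in> {m. 0 < m \<and> rough p m} \<and> m \<le> N \<and> k < m \<and> k dvd m.
      fterm (p * m) * mangoldt (m div k) / ln (real m)) \<le> fterm (p * k)"
proof -
  define x where "x = ln (real (p * k))"
  have "1 * 1 < p * k" using p k by (intro mult_less_le_imp_less) auto
  then have x: "0 < x" unfolding x_def by (intro ln_gt_zero) linarith
  let ?Q = "{q. q \<in> {1..N} \<and> rough p q}"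
  let ?t = "\<lambda>q. mangoldt q / (real q * (x + ln (real q)) * (x + ln (real q) - ln (real p)))"
  have "(\<Sum>m | m \<in> {m. 0 < m \<and> rough p m} \<and> m \<le> N \<and> k < m \<and> k dvd m.
      fterm (p * m) * mangoldt (m div k) / ln (real m)) =
      (\<Sum>q | 0 < k * q \<and> rough p (k * q) \<and> k * q \<le> N \<and> 1 < q. 1 / real (p * k) * ?t q)"
  proof (intro sum.reindex_bij_witness[of _ "\<lambda>q. k * q" "\<lambda>m. m div k"])
    fix m assume m: "m \<in> {m. m \<in> {m. 0 < m \<and> rough p m} \<and> m \<le> N \<and> k < m \<and> k dvd m}"
    then obtain q where q: "m = k * q" by auto
    have "0 < q" using m q by (auto intro: Nat.gr0I)
    then have "ln (real (p * m)) = x + ln (real q)" "ln (real m) = x + ln (real q) - ln (real p)"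
      using p k by (simp_all add: x_def q ln_mult)
    then show "1 / real (p * k) * ?t (m div k) = fterm (p * m) * mangoldt (m div k) / ln (real m)"
      using k by (simp add: fterm_def q)
  qed (use k in auto)
  \<comment> \<open>The range grows to all rough q \<le> N; added terms are nonnegative because x
    \<ge> ln p.\<close>
  also have "\<dots> \<le> (\<Sum>q\<in>?Q. 1 / real (p * k) * ?t q)"
  proof (intro sum_mono2)
    show "{q. 0 < k * q \<and> rough p (k * q) \<and> k * q \<le> N \<and> 1 < q} \<subseteq> ?Q"
    proof
      fix q assume "q \<in> {q. 0 < k * q \<and> rough p (k * q) \<and> k * q \<le> N \<and> 1 < q}"
      then have q: "rough p (k * q)" "k * q \<le> N" "1 < q" by auto
      have "q \<le> k * q" using k by simp
      then have "q \<le> N" using q(2) by (rule order_trans)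
      with q show "q \<in> ?Q" using rough_dvd[of p "k * q" q] by simp
    qed
    fix q assume q: "q \<in> ?Q - {q. 0 < k * q \<and> rough p (k * q) \<and> k * q \<le> N \<and> 1 < q}"
    have "ln (real p) \<le> x" using p k by (simp add: x_def)
    moreover have "0 \<le> ln (real q)" using q by auto
    ultimately show "0 \<le> 1 / real (p * k) * ?t q"
      using x by (intro mult_nonneg_nonneg divide_nonneg_nonneg mangoldt_nonneg) auto
  qed auto
  also have "\<dots> = 1 / real (p * k) * (\<Sum>q\<in>?Q. ?t q)"
    by (simp only: sum_distrib_left)
  also have "\<dots> \<le> 1 / real (p * k) * (1 / x)"
    using sum_rough_over_ln_product_le[OF p x] by (intro mult_left_mono) auto
  also have "\<dots> = fterm (p * k)"
    by (simp add: fterm_def x_def)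
  finally show ?thesis .
qed

lemma fterm_nonneg: "0 \<le> fterm n"
  by (cases "n = 0") (auto simp: fterm_def)

lemma least_prime_factor_eqD:
  assumes "least_prime_factor n = p" "2 \<le> n"
  shows "p dvd n" "rough p n"
proof -
  have ne: "prime_factors n \<noteq> {}"
    using assms(2) by (simp add: prime_factorization_empty_iff)
  then have "p \<in> prime_factors n"
    using assms(1) Min_in[of "prime_factors n"] by (auto simp: least_prime_factor_def)
  then show "p dvd n" by auto
  show "rough p n"
    unfolding rough_def
  proof (intro allI impI)
    fix r assume "prime r" "r dvd n"
    then have "r \<in> prime_factors n"
      using assms(2) by (auto simp: prime_factors_dvd)
    then show "p \<le> r"
      using assms(1) by (auto simp: least_prime_factor_def)
  qed
qed

text \<open>Division by p turns \<open>F\<close> into an antichain of p-rough numbers, to which the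
  transport bound applies with weights \<open>fterm (p * k)\<close>.\<close>

lemma sum_fterm_Ap_le:
  assumes A: "primitive A" and p: "prime p" "2 < p" and F: "finite F" "F \<subseteq> Ap A p"
  shows "sum fterm F \<le> fterm p"
proof -
  define K where "K = (\<lambda>n. n div p) ` F"
  have F_props: "p * (n div p) = n" "0 < n div p" "rough p (n div p)" "n \<in> A" if "n \<in> F" for n
  proof -
    show "n \<in> A" using that F(2) by (auto simp: Ap_def)
    have n: "least_prime_factor n = p" "2 \<le> n"
      using that F(2) A by (auto simp: Ap_def primitive_def)
    note * = least_prime_factor_eqD[OF n]
    from *(1) show pn: "p * (n div p) = n" by simp
    then show "0 < n div p" using n(2) by (cases "n div p = 0") auto
    from pn have "n div p dvd n" by (metis dvd_triv_right)
    with *(2) show "rough p (n div p)" by (rule rough_dvd)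
  qed
  have "inj_on (\<lambda>n. n div p) F"
    using F_props(1) by (intro inj_on_inverseI[where g = "\<lambda>k. p * k"])
  then have "sum fterm F = (\<Sum>k\<in>K. fterm (p * k))"
    using F_props(1) by (simp add: K_def sum.reindex)
  also have "\<dots> \<le> fterm (p * 1)"
  proof (rule sum_antichain_le[where R = "{m. 0 < m \<and> rough p m}" and N = "Max K"])
    show "1 \<in> {m. 0 < m \<and> rough p m}"
      by (auto simp: rough_def)
    show "K \<subseteq> {m. 0 < m \<and> rough p m}"
      using F_props by (auto simp: K_def)
    show "K \<subseteq> {..Max K}"
      using F(1) by (auto simp: K_def)
    show "d \<in> {m. 0 < m \<and> rough p m}" if "m \<in> {m. 0 < m \<and> rough p m}" "d dvd m" for m d
      using that rough_dvd[of p m d] dvd_pos_nat[of m d] by simp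
    show "a = b" if "a \<in> K" "b \<in> K" "a dvd b" for a b
    proof -
      have "p * a \<in> A" "p * b \<in> A" "p * a dvd p * b"
        using that F_props by (auto simp: K_def)
      then have "p * a = p * b"
        using A unfolding primitive_def by blast
      then show ?thesis using p by simp
    qed
  qed (use rough_multiple_flow_le[OF p] fterm_nonneg in auto)
  finally show ?thesis by simp
qed

theorem theorem1p3:
  fixes A :: "nat set" and p :: nat
  assumes "primitive A" and "prime p" and "p > 2"
  shows "fterm summable_on (Ap A p) \<and> f (Ap A p) \<le> f {p} \<and> f {p} = 1 / (real p * ln (real p))"
proof (intro conjI)
  note bound = sum_fterm_Ap_le[OF assms]
  \<comment> \<open>Without summability the infinite sum would default to 0 and the inequality would
    say nothing.\<close>
  show summable: "fterm summable_on (Ap A p)"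
    using bound by (intro nonneg_bdd_above_summable_on bdd_aboveI[of _ "fterm p"]) (auto simp: fterm_nonneg)
  have "f (Ap A p) \<le> fterm p"
    unfolding f_def using summable bound by (intro infsum_le_finite_sums) auto
  then show "f (Ap A p) \<le> f {p}"
    by (simp add: f_def)
  show "f {p} = 1 / (real p * ln (real p))"
    by (simp add: f_def fterm_def)
qed

end
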